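(* Let $(X_t)_{t\ge0}$ be a Markov process in $\mathbb{R}^d$ with càdlàg sample paths and let $f:[0,1]\to[0,\infty)$ be a non-decreasing function. If $$\int_0^1\frac1t\sup_{|z-x|\le f(t)}\mathbb{P}^z\left(\sup_{s\le t}|X_s-z|\ge f(t)\right)dt<\infty$$ for some $x\in\mathbb{R}^d$, then $$\limsup_{t\to0}\frac1{f(t)}\sup_{s\le t}|X_s-x|\le4\quad\mathbb{P}^x\text{-a.s.}$$
   Context: A Markov process is a time-homogeneous Markov family $(X_t,t\ge0;\mathbb{P}^x,x\in\mathbb{R}^d)$ with state space $\mathbb{R}^d$, where $\mathbb{P}^x(X_0=x)=1$. *)

theory Defs
  imports "HOL-Probability.Probability"
begin

definition natural_filtration ::
  "'w measure \<Rightarrow> (real \<Rightarrow> 'w \<Rightarrow> 'a::topological_space) \<Rightarrow> real \<Rightarrow> 'w measure" where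
  "natural_filtration M X s =
     sigma (space M) {X r -` B \<inter> space M | r B. 0 \<le> r \<and> r \<le> s \<and> B \<in> sets borel}"

text \<open>
  The measurable space underlying all the laws \<open>P x\<close> is carried by \<open>M\<close>, whose measure is not
  used. Time is \<open>[0, \<infinity>)\<close>; the values of \<open>X t\<close> for negative \<open>t\<close> are irrelevant.
  The Markov property is required with respect to the natural filtration only. It follows from
  the Markov property for any larger filtration to which the process is adapted.
\<close>

locale markov_process =
  fixes M :: "'w measure"
    and P :: "'a::euclidean_space \<Rightarrow> 'w measure"
    and X :: "real \<Rightarrow> 'w \<Rightarrow> 'a"
  assumes prob_space_law: "prob_space (P x)"
    and sets_law: "sets (P x) = sets M"
    and random_variable: "0 \<le> t \<Longrightarrow> X t \<in> borel_measurable M"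
    and measurable_start:
      "0 \<le> t \<Longrightarrow> B \<in> sets borel \<Longrightarrow>
         (\<lambda>x. measure (P x) {\<omega> \<in> space M. X t \<omega> \<in> B}) \<in> borel_measurable borel"
    and start: "measure (P x) {\<omega> \<in> space M. X 0 \<omega> = x} = 1"
    and markov:
      "0 \<le> s \<Longrightarrow> 0 \<le> t \<Longrightarrow> B \<in> sets borel \<Longrightarrow>
         AE \<omega> in P x.
           real_cond_exp (P x) (natural_filtration M X s)
             (indicator {\<omega>' \<in> space M. X (s + t) \<omega>' \<in> B}) \<omega>
           = measure (P (X s \<omega>)) {\<omega>' \<in> space M. X t \<omega>' \<in> B}"

definition cadlag :: "(real \<Rightarrow> 'a::topological_space) \<Rightarrow> bool" where
  "cadlag g \<longleftrightarrow>
     (\<forall>t\<ge>0. (g \<longlongrightarrow> g t) (at_right t)) \<and> (\<forall>t>0. \<exists>l. (g \<longlongrightarrow> l) (at_left t))"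

end

theory Submission
  imports Defs
begin

text \<open>
  Write \<open>g t\<close> for the supremum of probabilities in the integrand. By the Markov property at time
  \<open>t\<close>, the process leaves the ball of radius \<open>2 * f t\<close> before time \<open>2 * t\<close> with probability at most
  \<open>2 * g t\<close>. Finiteness of the integral provides times \<open>\<tau> n\<close>, tending to \<open>0\<close> with successive
  ratios less than \<open>2\<close>, such that \<open>g (\<tau> n)\<close> is summable. By the Borel-Cantelli lemma
  almost every path eventually stays within \<open>2 * f (\<tau> n)\<close> up to time \<open>2 * \<tau> n\<close>, and monotonicity
  of \<open>f\<close> fills the gaps between these times.
\<close>

section \<open>Reduction of suprema over an interval to countable suprema\<close>

text \<open>By right-continuity, a value above the right-hand supremum at some \<open>s < t\<close>
  would persist at a rational just after \<open>s\<close>. The endpoint \<open>t\<close> has no room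
  to its right inside the interval, so it is inserted by hand. The countable form is what makes
  running maxima measurable.\<close>

lemma SUP_Icc_eq_SUP_rat:
  fixes g :: "real \<Rightarrow> 'b::{complete_linorder, linorder_topology}"
  assumes t: "0 \<le> t" and g: "\<And>s. 0 \<le> s \<Longrightarrow> (g \<longlongrightarrow> g s) (at_right s)"
  shows "(SUP s\<in>{0..t}. g s) = (SUP s\<in>insert t ({0..t} \<inter> \<rat>). g s)" (is "_ = ?R")
proof (rule antisym)
  show "(SUP s\<in>{0..t}. g s) \<le> ?R"
  proof (rule SUP_least)
    fix s assume s: "s \<in> {0..t}"
    show "g s \<le> ?R"
    proof (rule ccontr)
      assume "\<not> g s \<le> ?R"
      then have less: "?R < g s" by simp
      then have "s \<noteq> t" by (metis SUP_upper insertI1 leD)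
      with s have "s < t" by simp
      have "eventually (\<lambda>u. ?R < g u) (at_right s)"
        by (rule order_tendstoD(1)[OF g less]) (use s in simp)
      then obtain b where b: "s < b" "\<And>u. s < u \<Longrightarrow> u < b \<Longrightarrow> ?R < g u"
        by (auto simp: eventually_at_right_field)
      \<comment> \<open>Cutting at \<open>min b t\<close> keeps the rational both in the right
        neighbourhood of \<open>s\<close> and in the interval.\<close>
      obtain u where u: "u \<in> \<rat>" "s < u" "u < min b t"
        using Rats_dense_in_real[of s "min b t"] b \<open>s < t\<close> by auto
      then have "g u \<le> ?R" using s by (intro SUP_upper) auto
      with b(2)[of u] u show False by simp
    qed
  qed
  show "?R \<le> (SUP s\<in>{0..t}. g s)"
    by (rule SUP_subset_mono) (use t in auto)
qed

section \<open>Natural filtration and measurability of one-time events\<close>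

context markov_process
begin

lemma space_law: "space (P x) = space M"
  using sets_law by (rule sets_eq_imp_space_eq)

lemma random_variable_law [measurable]: "0 \<le> t \<Longrightarrow> X t \<in> borel_measurable (P x)"
  using random_variable by (simp cong: measurable_cong_sets add: sets_law)

lemma sets_natural_filtration:
  "sets (natural_filtration M X s) =
     sigma_sets (space M) {X r -` B \<inter> space M | r B. 0 \<le> r \<and> r \<le> s \<and> B \<in> sets borel}"
  unfolding natural_filtration_def by (rule sets_measure_of) auto

lemma natural_filtration_mono:
  assumes "s \<le> t"
  shows "sets (natural_filtration M X s) \<subseteq> sets (natural_filtration M X t)"
  unfolding sets_natural_filtration by (rule sigma_sets_mono') (use assms in force)

lemma natural_filtration_event:
  assumes "0 \<le> s" "B \<in> sets borel"
  shows "{\<omega> \<in> space M. X s \<omega> \<in> B} \<in> sets (natural_filtration M X s)"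
  unfolding sets_natural_filtration
  by (rule sigma_sets.Basic) (use assms in force)

lemma subalgebra_natural_filtration: "subalgebra (P x) (natural_filtration M X s)"
proof -
  have "sigma_sets (space M) {X r -` B \<inter> space M | r B. 0 \<le> r \<and> r \<le> s \<and> B \<in> sets borel}
      \<subseteq> sets M"
    by (rule sets.sigma_sets_subset) (auto intro!: measurable_sets[OF random_variable])
  then show ?thesis
    by (simp add: subalgebra_def sets_natural_filtration sets_law space_law)
       (simp add: natural_filtration_def space_measure_of_conv)
qed

lemma natural_filtration_sets_law:
  "C \<in> sets (natural_filtration M X s) \<Longrightarrow> C \<in> sets (P x)"
  using subalgebra_natural_filtration by (auto simp: subalgebra_def)

lemma sets_event: "0 \<le> t \<Longrightarrow> B \<in> sets borel \<Longrightarrow> {\<omega> \<in> space M. X t \<omega> \<in> B} \<in> sets (P x)"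
  using natural_filtration_event natural_filtration_sets_law by blast

section \<open>The Markov property for functions and for finitely many times\<close>

text \<open>Integrating the conditional probability over a past event \<open>C\<close> turns the
  almost sure Markov property into an identity of integrals; later extensions start from it and
  never return to conditional expectations.\<close>

lemma markov_event:
  assumes s: "0 \<le> s" and u: "0 \<le> u" and C: "C \<in> sets (natural_filtration M X s)"
    and B: "B \<in> sets borel"
  shows "emeasure (P x) (C \<inter> {\<omega> \<in> space M. X (s + u) \<omega> \<in> B}) =
    (\<integral>\<^sup>+\<omega>\<in>C. emeasure (P (X s \<omega>)) {\<omega>' \<in> space M. X u \<omega>' \<in> B} \<partial>P x)"
proof -
  interpret prob_space "P x" by (rule prob_space_law)
  interpret finite_measure_subalgebra "P x" "natural_filtration M X s"
    by unfold_locales (rule subalgebra_natural_filtration)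
  define E where "E = {\<omega> \<in> space M. X (s + u) \<omega> \<in> B}"
  define h where "h z = measure (P z) {\<omega>' \<in> space M. X u \<omega>' \<in> B}" for z
  have E: "E \<in> sets (P x)" using sets_event s u B by (simp add: E_def)
  have C': "C \<in> sets (P x)" using C by (rule natural_filtration_sets_law)
  have [measurable]: "h \<in> borel_measurable borel"
    unfolding h_def using u B by (rule measurable_start)
  have [measurable]: "X s \<in> borel_measurable (P x)" using s by simp
  have h1: "0 \<le> h z" "h z \<le> 1" for z
    unfolding h_def by (simp_all add: prob_space.prob_le_1[OF prob_space_law])
  have int: "integrable (P x) (indicator E :: _ \<Rightarrow> real)"
    using E by (simp add: integrable_indicator_iff emeasure_eq_measure)
  have inth: "integrable (P x) (\<lambda>\<omega>. indicator C \<omega> * h (X s \<omega>))"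
    by (rule integrable_const_bound[of _ 1]) (use C' h1 in \<open>auto simp: indicator_def\<close>)
  have "ennreal (measure (P x) (C \<inter> E)) = ennreal (\<integral>\<omega>\<in>C. indicator E \<omega> \<partial>P x)"
    using C' E by (simp add: set_lebesgue_integral_def indicator_inter_arith[symmetric])
  also have "(\<integral>\<omega>\<in>C. indicator E \<omega> \<partial>P x) =
      (\<integral>\<omega>\<in>C. real_cond_exp (P x) (natural_filtration M X s) (indicator E) \<omega> \<partial>P x)"
    using int C by (rule real_cond_exp_intA)
  also have "\<dots> = (\<integral>\<omega>\<in>C. h (X s \<omega>) \<partial>P x)"
    unfolding set_lebesgue_integral_def
  proof (rule integral_cong_AE)
    show "AE \<omega> in P x. indicator C \<omega> *\<^sub>R
        real_cond_exp (P x) (natural_filtration M X s) (indicator E) \<omega> =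
        indicator C \<omega> *\<^sub>R h (X s \<omega>)"
      using markov[OF s u B, of x] unfolding E_def h_def by eventually_elim simp
  qed (use C' in measurable)
  also have "ennreal \<dots> = (\<integral>\<^sup>+\<omega>. ennreal (indicator C \<omega> * h (X s \<omega>)) \<partial>P x)"
    unfolding set_lebesgue_integral_def real_scaleR_def
    by (rule nn_integral_eq_integral[symmetric]) (use inth h1 in auto)
  also have "\<dots> = (\<integral>\<^sup>+\<omega>\<in>C. ennreal (h (X s \<omega>)) \<partial>P x)"
    by (rule nn_integral_cong) (auto simp: indicator_def)
  also have "\<dots> = (\<integral>\<^sup>+\<omega>\<in>C. emeasure (P (X s \<omega>)) {\<omega>' \<in> space M. X u \<omega>' \<in> B} \<partial>P x)"
    by (simp add: h_def finite_measure.emeasure_eq_measure prob_space.finite_measure prob_space_law)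
  finally show ?thesis unfolding E_def emeasure_eq_measure .
qed

text \<open>Approximation by simple functions extends \<open>measurable_start\<close> from
  indicators to nonnegative Borel functions. This lets functions produced by the transition operator
  be inserted into it again.\<close>

lemma measurable_semigroup:
  assumes u: "0 \<le> u" and \<phi>: "\<phi> \<in> borel_measurable borel"
  shows "(\<lambda>z. \<integral>\<^sup>+\<omega>. \<phi> (X u \<omega>) \<partial>P z) \<in> borel_measurable borel"
  using \<phi>
proof (induction rule: borel_measurable_induct)
  case (cong f g)
  then have "f = g" by auto
  with cong show ?case by simp
next
  case (set A)
  have "(\<integral>\<^sup>+\<omega>. indicator A (X u \<omega>) \<partial>P z) = ennreal (measure (P z) {\<omega> \<in> space M. X u \<omega> \<in> A})"
    for z
  proof -
    have "(\<integral>\<^sup>+\<omega>. indicator A (X u \<omega>) \<partial>P z) =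
        (\<integral>\<^sup>+\<omega>. indicator {\<omega> \<in> space M. X u \<omega> \<in> A} \<omega> \<partial>P z)"
      by (rule nn_integral_cong) (auto simp: indicator_def space_law)
    also have "\<dots> = emeasure (P z) {\<omega> \<in> space M. X u \<omega> \<in> A}"
      using sets_event[OF u set] by simp
    finally show ?thesis
      by (simp add: finite_measure.emeasure_eq_measure prob_space.finite_measure prob_space_law)
  qed
  then show ?case using measurable_start[OF u set] by simp
next
  case (mult v c)
  have "(\<lambda>\<omega>. v (X u \<omega>)) \<in> borel_measurable (P z)" for z using u mult by measurable
  then show ?case using mult by (simp add: nn_integral_cmult)
next
  case (add v w)
  have "(\<lambda>\<omega>. v (X u \<omega>)) \<in> borel_measurable (P z)" "(\<lambda>\<omega>. w (X u \<omega>)) \<in> borel_measurable (P z)"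
    for z using u add by measurable
  then show ?case using add by (simp add: nn_integral_add)
next
  case (seq U)
  have m: "(\<lambda>\<omega>. U i (X u \<omega>)) \<in> borel_measurable (P z)" for i z using u seq by measurable
  have "(\<integral>\<^sup>+\<omega>. (SUP i. U i) (X u \<omega>) \<partial>P z) = (SUP i. \<integral>\<^sup>+\<omega>. U i (X u \<omega>) \<partial>P z)" for z
    unfolding SUP_apply
    by (rule nn_integral_monotone_convergence_SUP)
       (use m seq in \<open>auto simp: incseq_def le_fun_def\<close>)
  then show ?case using seq by simp
qed

text \<open>The same approximation applied to \<open>markov_event\<close>: indicators, then linear
  combinations, then monotone limits. \<open>measurable_semigroup\<close> makes the inner integral a
  measurable function of \<open>X s\<close>.\<close>

lemma markov_nn_integral:
  assumes s: "0 \<le> s" and u: "0 \<le> u" and C: "C \<in> sets (natural_filtration M X s)"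
    and \<phi>: "\<phi> \<in> borel_measurable borel"
  shows "(\<integral>\<^sup>+\<omega>\<in>C. \<phi> (X (s + u) \<omega>) \<partial>P x) =
    (\<integral>\<^sup>+\<omega>\<in>C. (\<integral>\<^sup>+\<omega>'. \<phi> (X u \<omega>') \<partial>P (X s \<omega>)) \<partial>P x)"
  using \<phi>
proof (induction rule: borel_measurable_induct)
  case (cong f g)
  then have "f = g" by auto
  with cong show ?case by simp
next
  case (set A)
  have "(\<integral>\<^sup>+\<omega>\<in>C. indicator A (X (s + u) \<omega>) \<partial>P x) =
      (\<integral>\<^sup>+\<omega>. indicator (C \<inter> {\<omega> \<in> space M. X (s + u) \<omega> \<in> A}) \<omega> \<partial>P x)"
    by (rule nn_integral_cong) (auto simp: indicator_def space_law)
  also have "\<dots> = emeasure (P x) (C \<inter> {\<omega> \<in> space M. X (s + u) \<omega> \<in> A})"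
    using natural_filtration_sets_law[OF C] sets_event[OF _ set, of "s + u"] s u by simp
  also have "\<dots> = (\<integral>\<^sup>+\<omega>\<in>C. emeasure (P (X s \<omega>)) {\<omega>' \<in> space M. X u \<omega>' \<in> A} \<partial>P x)"
    using s u C set by (rule markov_event)
  also have "\<dots> = (\<integral>\<^sup>+\<omega>\<in>C. (\<integral>\<^sup>+\<omega>'. indicator A (X u \<omega>') \<partial>P (X s \<omega>)) \<partial>P x)"
  proof (rule nn_integral_cong)
    fix \<omega>
    have "(\<integral>\<^sup>+\<omega>'. indicator A (X u \<omega>') \<partial>P z) =
        (\<integral>\<^sup>+\<omega>'. indicator {\<omega>' \<in> space M. X u \<omega>' \<in> A} \<omega>' \<partial>P z)" for z
      by (rule nn_integral_cong) (auto simp: indicator_def space_law)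
    then show "emeasure (P (X s \<omega>)) {\<omega>' \<in> space M. X u \<omega>' \<in> A} * indicator C \<omega> =
        (\<integral>\<^sup>+\<omega>'. indicator A (X u \<omega>') \<partial>P (X s \<omega>)) * indicator C \<omega>"
      using sets_event[OF u set] by simp
  qed
  finally show ?case .
next
  case (mult v c)
  have [measurable]: "C \<in> sets (P x)" using C by (rule natural_filtration_sets_law)
  have [measurable]: "X s \<in> borel_measurable (P x)" "X (s + u) \<in> borel_measurable (P x)"
    using s u by simp_all
  note [measurable] = mult(2) measurable_semigroup[OF u mult(2)]
  have "(\<lambda>\<omega>. v (X u \<omega>)) \<in> borel_measurable (P z)" for z using u mult by measurable
  then show ?case using mult by (simp add: nn_integral_cmult mult.assoc)
next
  case (add v w)
  have [measurable]: "C \<in> sets (P x)" using C by (rule natural_filtration_sets_law)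
  have [measurable]: "X s \<in> borel_measurable (P x)" "X (s + u) \<in> borel_measurable (P x)"
    using s u by simp_all
  have v: "v \<in> borel_measurable borel" and w: "w \<in> borel_measurable borel" by fact+
  note [measurable] = v w measurable_semigroup[OF u v] measurable_semigroup[OF u w]
  have "(\<lambda>\<omega>. v (X u \<omega>)) \<in> borel_measurable (P z)" "(\<lambda>\<omega>. w (X u \<omega>)) \<in> borel_measurable (P z)"
    for z using u add by measurable
  then show ?case using add by (simp add: nn_integral_add distrib_right)
next
  case (seq U)
  have [measurable]: "C \<in> sets (P x)" using C by (rule natural_filtration_sets_law)
  have [measurable]: "X s \<in> borel_measurable (P x)" "X (s + u) \<in> borel_measurable (P x)"
    using s u by simp_all
  note [measurable] = seq(1) measurable_semigroup[OF u seq(1)]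
  have m: "(\<lambda>\<omega>. U i (X u \<omega>)) \<in> borel_measurable (P z)" for i z using u seq by measurable
  have inc: "U i z \<le> U j z" if "i \<le> j" for i j z
    using seq that by (auto simp: incseq_def le_fun_def)
  \<comment> \<open>Monotone convergence is used three times: inside under each \<open>P z\<close>,
    outside at time \<open>s + u\<close>, and outside again for the inner integrals at
    \<open>X s\<close>, which increase in \<open>i\<close>.\<close>
  have inner: "(\<integral>\<^sup>+\<omega>. (SUP i. U i) (X u \<omega>) \<partial>P z) = (SUP i. \<integral>\<^sup>+\<omega>. U i (X u \<omega>) \<partial>P z)" for z
    unfolding SUP_apply
    by (rule nn_integral_monotone_convergence_SUP) (use m inc in \<open>auto simp: incseq_def le_fun_def\<close>)
  have "(\<integral>\<^sup>+\<omega>\<in>C. (SUP i. U i) (X (s + u) \<omega>) \<partial>P x) =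
      (\<integral>\<^sup>+\<omega>. (SUP i. U i (X (s + u) \<omega>) * indicator C \<omega>) \<partial>P x)"
    by (simp add: SUP_mult_right_ennreal image_comp)
  also have "\<dots> = (SUP i. \<integral>\<^sup>+\<omega>\<in>C. U i (X (s + u) \<omega>) \<partial>P x)"
    by (rule nn_integral_monotone_convergence_SUP)
       (use inc in \<open>auto simp: incseq_def le_fun_def intro!: mult_right_mono\<close>)
  also have "\<dots> = (SUP i. \<integral>\<^sup>+\<omega>\<in>C. (\<integral>\<^sup>+\<omega>'. U i (X u \<omega>') \<partial>P (X s \<omega>)) \<partial>P x)"
    using seq by simp
  also have "\<dots> = (\<integral>\<^sup>+\<omega>. (SUP i. (\<integral>\<^sup>+\<omega>'. U i (X u \<omega>') \<partial>P (X s \<omega>)) * indicator C \<omega>) \<partial>P x)"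
    by (rule nn_integral_monotone_convergence_SUP[symmetric])
       (use inc in \<open>auto simp: incseq_def le_fun_def intro!: mult_right_mono nn_integral_mono\<close>)
  also have "\<dots> = (\<integral>\<^sup>+\<omega>\<in>C. (\<integral>\<^sup>+\<omega>'. (SUP i. U i) (X u \<omega>') \<partial>P (X s \<omega>)) \<partial>P x)"
    unfolding inner by (simp add: SUP_mult_right_ennreal)
  finally show ?case .
qed

text \<open>
  The offset \<open>c\<close> is needed for the induction: the process is restarted at the smallest time \<open>b\<close>,
  which turns the remaining times \<open>a\<close> into \<open>a - b\<close>.
\<close>

lemma markov_finite_dim:
  assumes "finite A" "0 \<le> c" "\<And>a. a \<in> A \<Longrightarrow> c \<le> a" "\<And>a. a \<in> A \<Longrightarrow> B a \<in> sets borel"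
  shows "(\<lambda>z. emeasure (P z) {\<omega> \<in> space M. \<forall>a\<in>A. X (a - c) \<omega> \<in> B a}) \<in> borel_measurable borel"
    and "\<And>x s C. 0 \<le> s \<Longrightarrow> C \<in> sets (natural_filtration M X s) \<Longrightarrow>
      emeasure (P x) (C \<inter> {\<omega> \<in> space M. \<forall>a\<in>A. X (s + (a - c)) \<omega> \<in> B a}) =
      (\<integral>\<^sup>+\<omega>\<in>C. emeasure (P (X s \<omega>)) {\<omega>' \<in> space M. \<forall>a\<in>A. X (a - c) \<omega>' \<in> B a} \<partial>P x)"
  using assms
\<comment> \<open>New times enter below all old ones, so the constraint at \<open>b\<close> belongs
  to the past of the remaining times. Both claims are proved together because the measurability
  claim is what makes the function \<open>\<phi>\<close> below Borel.\<close>
proof (induction A arbitrary: c rule: finite_linorder_min_induct)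
  case empty
  have one: "emeasure (P z) (space M) = 1" for z
    using prob_space.emeasure_space_1[OF prob_space_law] by (simp add: space_law)
  {
    case 1
    show ?case by (simp add: one)
  next
    case (2 x s C)
    then have "C \<in> sets (P x)" by (simp add: natural_filtration_sets_law)
    moreover from this have "C \<inter> space M = C" using sets.sets_into_space space_law by fastforce
    ultimately show ?case by (simp add: one)
  }
next
  case (insert b A)
  \<comment> \<open>The value at time \<open>b\<close> must lie in \<open>B b\<close>, and a process
    restarted from that value must meet the remaining constraints.\<close>
  define \<phi> where "\<phi> z = indicator (B b) z *
    emeasure (P z) {\<omega> \<in> space M. \<forall>a\<in>A. X (a - b) \<omega> \<in> B a}" for z
  have ind: "(\<lambda>z. emeasure (P z) {\<omega> \<in> space M. \<forall>a\<in>A. X (a - b) \<omega> \<in> B a}) \<in> borel_measurable borel"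
    "0 \<le> s \<Longrightarrow> C \<in> sets (natural_filtration M X s) \<Longrightarrow>
      emeasure (P x) (C \<inter> {\<omega> \<in> space M. \<forall>a\<in>A. X (s + (a - b)) \<omega> \<in> B a}) =
      (\<integral>\<^sup>+\<omega>\<in>C. emeasure (P (X s \<omega>)) {\<omega>' \<in> space M. \<forall>a\<in>A. X (a - b) \<omega>' \<in> B a} \<partial>P x)"
    if "0 \<le> c" "c \<le> b" "\<And>a. a \<in> insert b A \<Longrightarrow> B a \<in> sets borel" for x s C c
    using insert.IH[where c = b] insert.hyps that by (fastforce simp: less_imp_le)+
  have *: "emeasure (P x) (C \<inter> {\<omega> \<in> space M. \<forall>a\<in>insert b A. X (s + (a - c)) \<omega> \<in> B a}) =
      (\<integral>\<^sup>+\<omega>\<in>C. \<phi> (X (s + (b - c)) \<omega>) \<partial>P x)"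
    if c: "0 \<le> c" "\<And>a. a \<in> insert b A \<Longrightarrow> c \<le> a"
      and B: "\<And>a. a \<in> insert b A \<Longrightarrow> B a \<in> sets borel"
      and s: "0 \<le> s" and C: "C \<in> sets (natural_filtration M X s)" for c s C x
  proof -
    have cb: "c \<le> b" using c by simp
    \<comment> \<open>The constraint at the first time is absorbed into the past event, and the
      induction hypothesis restarts the process at \<open>s + (b - c)\<close>.\<close>
    let ?C = "C \<inter> {\<omega> \<in> space M. X (s + (b - c)) \<omega> \<in> B b}"
    have C': "?C \<in> sets (natural_filtration M X (s + (b - c)))"
      using C natural_filtration_mono[of s "s + (b - c)"] cb s B
      by (intro sets.Int natural_filtration_event) auto
    have "C \<inter> {\<omega> \<in> space M. \<forall>a\<in>insert b A. X (s + (a - c)) \<omega> \<in> B a} =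
        ?C \<inter> {\<omega> \<in> space M. \<forall>a\<in>A. X (s + (b - c) + (a - b)) \<omega> \<in> B a}"
      by auto
    then have "emeasure (P x) (C \<inter> {\<omega> \<in> space M. \<forall>a\<in>insert b A. X (s + (a - c)) \<omega> \<in> B a}) =
        (\<integral>\<^sup>+\<omega>\<in>?C. emeasure (P (X (s + (b - c)) \<omega>))
          {\<omega>' \<in> space M. \<forall>a\<in>A. X (a - b) \<omega>' \<in> B a} \<partial>P x)"
      using ind(2)[of c "s + (b - c)" ?C x] c cb B C' s by simp
    also have "\<dots> = (\<integral>\<^sup>+\<omega>\<in>C. \<phi> (X (s + (b - c)) \<omega>) \<partial>P x)"
      by (rule nn_integral_cong) (auto simp: \<phi>_def indicator_def space_law)
    finally show ?thesis .
  qed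
  have space_nf: "space M \<in> sets (natural_filtration M X 0)"
    unfolding sets_natural_filtration by (rule sigma_sets_top)
  \<comment> \<open>This is \<open>*\<close> at \<open>s = 0\<close> with the whole space as past
    event.\<close>
  have **: "emeasure (P z) {\<omega> \<in> space M. \<forall>a\<in>insert b A. X (a - c) \<omega> \<in> B a} =
      (\<integral>\<^sup>+\<omega>. \<phi> (X (b - c) \<omega>) \<partial>P z)"
    if "0 \<le> c" "\<And>a. a \<in> insert b A \<Longrightarrow> c \<le> a" "\<And>a. a \<in> insert b A \<Longrightarrow> B a \<in> sets borel" for z c
  proof -
    have "emeasure (P z) {\<omega> \<in> space M. \<forall>a\<in>insert b A. X (a - c) \<omega> \<in> B a} =
        emeasure (P z) (space M \<inter> {\<omega> \<in> space M. \<forall>a\<in>insert b A. X (0 + (a - c)) \<omega> \<in> B a})"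
      by (rule arg_cong[where f = "emeasure (P z)"]) auto
    also have "\<dots> = (\<integral>\<^sup>+\<omega>\<in>space M. \<phi> (X (0 + (b - c)) \<omega>) \<partial>P z)"
      by (rule *) (use that space_nf in auto)
    also have "\<dots> = (\<integral>\<^sup>+\<omega>. \<phi> (X (b - c) \<omega>) \<partial>P z)"
      by (rule nn_integral_cong) (simp add: space_law)
    finally show ?thesis .
  qed
  have \<phi>: "\<phi> \<in> borel_measurable borel"
    if "0 \<le> c" "\<And>a. a \<in> insert b A \<Longrightarrow> c \<le> a" "\<And>a. a \<in> insert b A \<Longrightarrow> B a \<in> sets borel" for c
    unfolding \<phi>_def using ind(1)[of c] that by (auto intro!: borel_measurable_times)
  {
    case (1 c)
    have "c \<le> b" using 1 by simp
    moreover have "\<phi> \<in> borel_measurable borel" by (rule \<phi>[of c]) (use 1 in auto)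
    ultimately have "(\<lambda>z. \<integral>\<^sup>+\<omega>. \<phi> (X (b - c) \<omega>) \<partial>P z) \<in> borel_measurable borel"
      by (intro measurable_semigroup) auto
    also have "(\<lambda>z. \<integral>\<^sup>+\<omega>. \<phi> (X (b - c) \<omega>) \<partial>P z) =
        (\<lambda>z. emeasure (P z) {\<omega> \<in> space M. \<forall>a\<in>insert b A. X (a - c) \<omega> \<in> B a})"
      by (intro ext **[symmetric]) (use 1 in auto)
    finally show ?case .
  next
    case (2 x s C c)
    have "\<phi> \<in> borel_measurable borel" by (rule \<phi>[of c]) (use 2 in auto)
    then have "(\<integral>\<^sup>+\<omega>\<in>C. \<phi> (X (s + (b - c)) \<omega>) \<partial>P x) =
        (\<integral>\<^sup>+\<omega>\<in>C. (\<integral>\<^sup>+\<omega>'. \<phi> (X (b - c) \<omega>') \<partial>P (X s \<omega>)) \<partial>P x)"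
      by (intro markov_nn_integral) (use 2 in auto)
    also have "\<dots> = (\<integral>\<^sup>+\<omega>\<in>C. emeasure (P (X s \<omega>))
        {\<omega>' \<in> space M. \<forall>a\<in>insert b A. X (a - c) \<omega>' \<in> B a} \<partial>P x)"
      by (subst **) (use 2 in auto)
    finally have "(\<integral>\<^sup>+\<omega>\<in>C. \<phi> (X (s + (b - c)) \<omega>) \<partial>P x) = \<dots>" .
    then show ?case
      by (subst *) (use 2 in auto)
  }
qed

section \<open>The Markov property on path space\<close>

lemma measurable_path:
  assumes "0 \<le> s" "D \<subseteq> {0..}"
  shows "(\<lambda>\<omega>. \<lambda>d\<in>D. X (s + d) \<omega>) \<in> P x \<rightarrow>\<^sub>M (\<Pi>\<^sub>M d\<in>D. borel)"
  using assms by (intro measurable_restrict random_variable_law) auto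

text \<open>Dynkin's argument: cylinders form an intersection-stable generator of the product
  sigma-algebra, and on them \<open>markov_finite_dim\<close> applies. Measurability in the starting
  point is carried through the induction, since exchanging the integral with complements and
  countable sums relies on it.\<close>

lemma markov_path:
  fixes D :: "real set"
  assumes D: "D \<subseteq> {0..}" and A: "A \<in> sets (\<Pi>\<^sub>M d\<in>D. borel)" and s: "0 \<le> s"
  shows "emeasure (P x) {\<omega> \<in> space M. (\<lambda>d\<in>D. X (s + d) \<omega>) \<in> A} =
    (\<integral>\<^sup>+\<omega>. emeasure (P (X s \<omega>)) {\<omega>' \<in> space M. (\<lambda>d\<in>D. X d \<omega>') \<in> A} \<partial>P x)"
proof -
  let ?N = "\<Pi>\<^sub>M d\<in>D. (borel :: 'a measure)"
  let ?E = "\<lambda>s A. {\<omega> \<in> space M. (\<lambda>d\<in>D. X (s + d) \<omega>) \<in> A}"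
  have E: "?E s A \<in> sets (P z)" if "0 \<le> s" "A \<in> sets ?N" for s A z
    using measurable_sets[OF measurable_path[OF that(1) D] that(2), of z]
    by (simp add: vimage_def Int_def space_law conj_commute)
  have Xs: "X s \<in> borel_measurable (P x)" using s by simp
  have one: "emeasure (P z) (space M) = 1" for z
    using prob_space.emeasure_space_1[OF prob_space_law] by (simp add: space_law)
  have A': "A \<in> sigma_sets (\<Pi>\<^sub>E d\<in>D. space borel) (prod_algebra D (\<lambda>_. borel))"
    using A by (simp add: sets_PiM)
  have "(\<lambda>z. emeasure (P z) (?E 0 A)) \<in> borel_measurable borel \<and>
    emeasure (P x) (?E s A) = (\<integral>\<^sup>+\<omega>. emeasure (P (X s \<omega>)) (?E 0 A) \<partial>P x)"
    using Int_stable_prod_algebra prod_algebra_sets_into_space A'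
  proof (induction rule: sigma_sets_induct_disjoint)
    case (basic A)
    then obtain J B where J: "A = prod_emb D (\<lambda>_. borel) J (\<Pi>\<^sub>E j\<in>J. B j)" "finite J" "J \<subseteq> D"
      "\<And>j. j \<in> J \<Longrightarrow> B j \<in> sets borel"
      by (rule prod_algebraE) auto
    \<comment> \<open>The offset \<open>0\<close> is written out to match
      \<open>markov_finite_dim\<close> with \<open>c = 0\<close>.\<close>
    have EJ: "?E s A = {\<omega> \<in> space M. \<forall>j\<in>J. X (s + (j - 0)) \<omega> \<in> B j}" for s
      using J(3) unfolding J(1) prod_emb_def by (auto simp: restrict_PiE_iff PiE_iff)
    have EJ0: "?E 0 A = {\<omega> \<in> space M. \<forall>j\<in>J. X (j - 0) \<omega> \<in> B j}"
      unfolding EJ by simp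
    have J0: "\<And>j. j \<in> J \<Longrightarrow> 0 \<le> j" using J D by auto
    have top: "space M \<in> sets (natural_filtration M X s)"
      unfolding sets_natural_filtration by (rule sigma_sets_top)
    have "(\<lambda>z. emeasure (P z) (?E 0 A)) \<in> borel_measurable borel"
      unfolding EJ0 by (rule markov_finite_dim(1)) (use J J0 in auto)
    moreover have "emeasure (P x) (space M \<inter> ?E s A) =
        (\<integral>\<^sup>+\<omega>\<in>space M. emeasure (P (X s \<omega>)) (?E 0 A) \<partial>P x)"
      unfolding EJ[of s] EJ0
      by (rule markov_finite_dim(2)) (use J J0 s top in auto)
    moreover have "space M \<inter> ?E s A = ?E s A" by auto
    moreover have "(\<integral>\<^sup>+\<omega>\<in>space M. emeasure (P (X s \<omega>)) (?E 0 A) \<partial>P x) =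
        (\<integral>\<^sup>+\<omega>. emeasure (P (X s \<omega>)) (?E 0 A) \<partial>P x)"
      by (rule nn_integral_cong) (simp add: space_law)
    ultimately show ?case
      by (simp only: simp_thms)
  next
    case empty
    show ?case by simp
  next
    case (compl A)
    then have A: "A \<in> sets ?N" by (simp add: sets_PiM)
    have "?E s ((\<Pi>\<^sub>E d\<in>D. space borel) - A) = space M - ?E s A" for s by auto
    moreover have "emeasure (P z) (space M - ?E s A) = 1 - emeasure (P z) (?E s A)"
      if "0 \<le> s" for s z
      using emeasure_compl[OF E[OF that A, of z]] finite_measure.emeasure_finite[OF prob_space.finite_measure[OF prob_space_law]]
      by (simp add: space_law one)
    ultimately have eq: "emeasure (P z) (?E s ((\<Pi>\<^sub>E d\<in>D. space borel) - A)) = 1 - emeasure (P z) (?E s A)"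
      if "0 \<le> s" for s z using that by simp
    have m: "(\<lambda>z. emeasure (P z) (?E 0 A)) \<in> borel_measurable borel"
      and IH: "emeasure (P x) (?E s A) = (\<integral>\<^sup>+\<omega>. emeasure (P (X s \<omega>)) (?E 0 A) \<partial>P x)"
      using compl.IH by blast+
    have le1: "emeasure (P z) (?E 0 A) \<le> 1" for z
      by (rule subprob_space.subprob_emeasure_le_1[OF prob_space_imp_subprob_space[OF prob_space_law]])
    \<comment> \<open>Subtraction in \<open>ennreal\<close> truncates at zero; the bound
      \<open>le1\<close> and finiteness of the subtracted integral make it pass through the
      integral.\<close>
    have "(\<integral>\<^sup>+\<omega>. 1 - emeasure (P (X s \<omega>)) (?E 0 A) \<partial>P x) =
        (\<integral>\<^sup>+\<omega>. 1 \<partial>P x) - (\<integral>\<^sup>+\<omega>. emeasure (P (X s \<omega>)) (?E 0 A) \<partial>P x)"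
    proof (rule nn_integral_diff)
      show "(\<integral>\<^sup>+\<omega>. emeasure (P (X s \<omega>)) (?E 0 A) \<partial>P x) \<noteq> \<infinity>"
        using IH finite_measure.emeasure_finite[OF prob_space.finite_measure[OF prob_space_law], of x "?E s A"]
        by simp
    qed (use le1 measurable_compose[OF Xs m] in auto)
    moreover have "(\<lambda>z. 1 - emeasure (P z) (?E 0 A)) \<in> borel_measurable borel"
      using m by (rule borel_measurable_minus_ennreal[OF borel_measurable_const])
    ultimately show ?case
      unfolding eq[OF s] eq[OF order_refl] IH by (simp add: one space_law)
  next
    case (union A)
    then have A: "\<And>i. A i \<in> sets ?N" by (auto simp: sets_PiM)
    have UN: "?E s (\<Union>i. A i) = (\<Union>i. ?E s (A i))" for s by auto
    have eq: "emeasure (P z) (?E s (\<Union>i. A i)) = (\<Sum>i. emeasure (P z) (?E s (A i)))"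
      if "0 \<le> s" for s z
    proof -
      have "disjoint_family (\<lambda>i. ?E s (A i))"
        using union.hyps(1) unfolding disjoint_family_on_def by blast
      moreover have "range (\<lambda>i. ?E s (A i)) \<subseteq> sets (P z)"
        using E[OF that A] by blast
      ultimately show ?thesis unfolding UN by (intro suminf_emeasure[symmetric])
    qed
    have m: "(\<lambda>z. emeasure (P z) (?E 0 (A i))) \<in> borel_measurable borel"
      and IH: "emeasure (P x) (?E s (A i)) = (\<integral>\<^sup>+\<omega>. emeasure (P (X s \<omega>)) (?E 0 (A i)) \<partial>P x)" for i
      using union.IH by blast+
    show ?case
      unfolding eq[OF s] eq[OF order_refl] IH
      using nn_integral_suminf[OF measurable_compose[OF Xs m]] borel_measurable_suminf_order[OF m] by auto
  qed
  then show ?thesis by simp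
qed

section \<open>Running maxima: measurability and the doubling estimate\<close>

text \<open>For right-continuous paths the running maximum is a supremum over countably many times,
  and countable suprema preserve measurability.\<close>

lemma sets_running_maximum:
  fixes z :: 'a and r t :: real
  assumes cadlag: "\<And>\<omega>. \<omega> \<in> space M \<Longrightarrow> cadlag (\<lambda>t. X t \<omega>)" and t: "0 \<le> t"
  shows "{\<omega> \<in> space M. ennreal r \<le> (SUP s\<in>{0..t}. ennreal (norm (X s \<omega> - z)))} \<in> sets (P x)"
proof -
  let ?D = "insert t ({0..t} \<inter> \<rat>)"
  have D: "countable ?D" using countable_rat by (auto intro: countable_Int2)
  have [measurable]: "X s \<in> borel_measurable (P x)" if "s \<in> ?D" for s
    using that t by auto
  have "(\<lambda>\<omega>. SUP s\<in>?D. ennreal (norm (X s \<omega> - z))) \<in> borel_measurable (P x)"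
    by (intro borel_measurable_SUP D) measurable
  moreover have eq: "(SUP s\<in>?D. ennreal (norm (X s \<omega> - z))) = (SUP s\<in>{0..t}. ennreal (norm (X s \<omega> - z)))"
    if "\<omega> \<in> space M" for \<omega>
    by (rule SUP_Icc_eq_SUP_rat[symmetric, OF t])
       (use cadlag[OF that] in \<open>auto simp: cadlag_def intro!: tendsto_intros\<close>)
  ultimately have "{\<omega> \<in> space (P x). ennreal r \<le> (SUP s\<in>?D. ennreal (norm (X s \<omega> - z)))} \<in> sets (P x)"
    by measurable
  also have "{\<omega> \<in> space (P x). ennreal r \<le> (SUP s\<in>?D. ennreal (norm (X s \<omega> - z)))} =
      {\<omega> \<in> space M. ennreal r \<le> (SUP s\<in>{0..t}. ennreal (norm (X s \<omega> - z)))}"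
    unfolding space_law by (rule Collect_cong, rule conj_cong[OF refl], simp only: eq)
  finally show ?thesis .
qed

lemma AE_start: "AE \<omega> in P x. X 0 \<omega> = x"
proof -
  interpret prob_space "P x" by (rule prob_space_law)
  have "{\<omega> \<in> space M. X 0 \<omega> = x} \<in> events"
    using sets_event[of 0 "{x}" x] by simp
  from AE_prob_1[OF start] show ?thesis by eventually_elim simp
qed

text \<open>
  Leaving the ball of radius \<open>2 * r\<close> before time \<open>2 * t\<close> requires either leaving the ball of
  radius \<open>r\<close> before time \<open>t\<close>, or moving by \<open>r\<close> during \<open>{t..2 * t}\<close> after restarting in that ball.
\<close>

lemma running_maximum_doubling:
  fixes x :: 'a and r t :: real
  assumes cadlag: "\<And>\<omega>. \<omega> \<in> space M \<Longrightarrow> cadlag (\<lambda>t. X t \<omega>)" and t: "0 \<le> t" and r: "0 \<le> r"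
    and p: "\<And>z. norm (z - x) \<le> r \<Longrightarrow>
      emeasure (P z) {\<omega> \<in> space M. ennreal r \<le> (SUP s\<in>{0..t}. ennreal (norm (X s \<omega> - z)))} \<le> p"
  shows "emeasure (P x)
    {\<omega> \<in> space M. ennreal (2 * r) \<le> (SUP s\<in>{0..2 * t}. ennreal (norm (X s \<omega> - x)))} \<le> 2 * p"
proof -
  \<comment> \<open>Since \<open>0 \<le> t\<close>, the time \<open>0\<close> is already among the
    rationals; inserting it explicitly exposes the starting coordinate \<open>y 0\<close>.\<close>
  let ?D = "insert t (insert 0 ({0..t} \<inter> \<rat>))"
  let ?N = "\<Pi>\<^sub>M d\<in>?D. (borel :: 'a measure)"
  \<comment> \<open>Displacement is measured from the path's own start \<open>y 0\<close>, so one
    event \<open>A\<close> serves all random restart points, and the ball condition on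
    \<open>y 0\<close> is part of it.\<close>
  define A where "A = {y \<in> space ?N. norm (y 0 - x) \<le> r \<and>
    ennreal r \<le> (SUP d\<in>?D. ennreal (norm (y d - y 0)))}"
  define H where "H z = {\<omega> \<in> space M. ennreal r \<le> (SUP s\<in>{0..t}. ennreal (norm (X s \<omega> - z)))}" for z
  define K where "K s = {\<omega> \<in> space M. (\<lambda>d\<in>?D. X (s + d) \<omega>) \<in> A}" for s
  have D: "countable ?D" using countable_rat by (auto intro: countable_Int2)
  have D0: "?D \<subseteq> {0..}" using t by auto
  have [measurable]: "(\<lambda>y. y d) \<in> ?N \<rightarrow>\<^sub>M borel" if "d \<in> ?D" for d
    using that by (rule measurable_component_singleton)
  have "(\<lambda>y. SUP d\<in>?D. ennreal (norm (y d - y 0))) \<in> borel_measurable ?N"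
    by (intro borel_measurable_SUP D) measurable
  moreover have "(\<lambda>y. norm (y 0 - x)) \<in> borel_measurable ?N"
    by measurable
  ultimately have A: "A \<in> sets ?N" unfolding A_def by measurable
  have SUP_D: "(SUP d\<in>?D. ennreal (norm (X (s + d) \<omega> - z))) =
      (SUP d\<in>{0..t}. ennreal (norm (X (s + d) \<omega> - z)))"
    if "\<omega> \<in> space M" "0 \<le> s" for s \<omega> z
  proof -
    \<comment> \<open>Shifting time by \<open>s\<close> preserves right-continuity.\<close>
    have "((\<lambda>d. X (s + d) \<omega>) \<longlongrightarrow> X (s + d) \<omega>) (at_right d)" if "0 \<le> d" for d
    proof -
      have "filterlim (\<lambda>d. s + d) (at_right (s + d)) (at_right d)"
        by (rule filterlim_at_withinI)
           (auto intro!: tendsto_intros simp: eventually_at_filter)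
      moreover have "((\<lambda>u. X u \<omega>) \<longlongrightarrow> X (s + d) \<omega>) (at_right (s + d))"
        using cadlag[OF \<open>\<omega> \<in> space M\<close>] \<open>0 \<le> s\<close> that by (simp add: cadlag_def)
      ultimately show ?thesis by (rule filterlim_compose[rotated])
    qed
    then have "(SUP d\<in>{0..t}. ennreal (norm (X (s + d) \<omega> - z))) =
        (SUP d\<in>insert t ({0..t} \<inter> \<rat>). ennreal (norm (X (s + d) \<omega> - z)))"
      by (intro SUP_Icc_eq_SUP_rat t tendsto_intros) auto
    moreover have "?D = insert t ({0..t} \<inter> \<rat>)" using t by auto
    ultimately show ?thesis by simp
  qed
  have K_iff: "\<omega> \<in> K s \<longleftrightarrow> \<omega> \<in> space M \<and> norm (X s \<omega> - x) \<le> r \<and>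
      ennreal r \<le> (SUP d\<in>{0..t}. ennreal (norm (X (s + d) \<omega> - X s \<omega>)))" if "0 \<le> s" for s \<omega>
  proof (cases "\<omega> \<in> space M")
    case True
    define y where "y = (\<lambda>d\<in>?D. X (s + d) \<omega>)"
    have y: "y \<in> space ?N" "y 0 = X s \<omega>" by (simp_all add: y_def space_PiM)
    have "(SUP d\<in>?D. ennreal (norm (y d - X s \<omega>))) =
        (SUP d\<in>?D. ennreal (norm (X (s + d) \<omega> - X s \<omega>)))"
      by (rule SUP_cong) (auto simp: y_def)
    also have "\<dots> = (SUP d\<in>{0..t}. ennreal (norm (X (s + d) \<omega> - X s \<omega>)))"
      using True that by (rule SUP_D)
    finally show ?thesis
      using True by (simp only: K_def A_def y_def[symmetric] y mem_Collect_eq simp_thms)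
  qed (simp add: K_def)
  have K: "K s \<in> sets (P z)" if "0 \<le> s" for s z
    using measurable_sets[OF measurable_path[OF that D0] A, of z]
    by (simp add: K_def vimage_def Int_def space_law conj_commute)
  have H: "H z \<in> sets (P y)" for y z
    unfolding H_def using cadlag t by (rule sets_running_maximum)
  \<comment> \<open>Inside the ball, \<open>K 0\<close> lies almost surely in \<open>H z\<close>,
    because the path starts at \<open>z\<close>. Outside it, \<open>K 0\<close> is null for the same
    reason. Hence \<open>p\<close> bounds all starting points, although it is assumed only for the
    ball.\<close>
  have K0: "emeasure (P z) (K 0) \<le> p" for z
  proof (cases "norm (z - x) \<le> r")
    case True
    have "emeasure (P z) (K 0) \<le> emeasure (P z) (H z)"
      by (rule emeasure_mono_AE)
         (use AE_start[of z] H in \<open>auto simp: K_iff H_def elim!: eventually_mono\<close>)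
    also have "\<dots> \<le> p" unfolding H_def using True by (rule p)
    finally show ?thesis .
  next
    case False
    have "emeasure (P z) (K 0) \<le> emeasure (P z) {}"
      by (rule emeasure_mono_AE)
         (use AE_start[of z] False in \<open>auto simp: K_iff elim!: eventually_mono\<close>)
    then show ?thesis by simp
  qed
  have "emeasure (P x) (K t) = (\<integral>\<^sup>+\<omega>. emeasure (P (X t \<omega>)) (K 0) \<partial>P x)"
    using markov_path[OF D0 A t, of x] by (simp add: K_def)
  also have "\<dots> \<le> (\<integral>\<^sup>+\<omega>. p \<partial>P x)" by (intro nn_integral_mono K0)
  also have "\<dots> = p" using prob_space.emeasure_space_1[OF prob_space_law] by simp
  finally have Kt: "emeasure (P x) (K t) \<le> p" .
  \<comment> \<open>Off \<open>H x\<close> the first supremum is strictly below \<open>r\<close>, so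
    \<open>X t \<omega>\<close> is in the ball. Being off \<open>K t\<close> then forces the second
    supremum below \<open>r\<close> too, and the triangle inequality contradicts
    \<open>2 * r\<close>.\<close>
  have "{\<omega> \<in> space M. ennreal (2 * r) \<le> (SUP s\<in>{0..2 * t}. ennreal (norm (X s \<omega> - x)))} \<subseteq> H x \<union> K t"
  proof (rule subsetI, rule ccontr)
    fix \<omega>
    assume \<omega>: "\<omega> \<in> {\<omega> \<in> space M. ennreal (2 * r) \<le> (SUP s\<in>{0..2 * t}. ennreal (norm (X s \<omega> - x)))}"
      and n: "\<omega> \<notin> H x \<union> K t"
    let ?a = "SUP s\<in>{0..t}. ennreal (norm (X s \<omega> - x))"
    let ?b = "SUP d\<in>{0..t}. ennreal (norm (X (t + d) \<omega> - X t \<omega>))"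
    have a: "?a < ennreal r" using n \<omega> by (auto simp: H_def not_le)
    have le: "ennreal (norm (X s \<omega> - x)) \<le> ?a" if "s \<in> {0..t}" for s
      using that by (rule SUP_upper)
    have "ennreal (norm (X t \<omega> - x)) < ennreal r"
      using le[of t] a t by (auto intro: le_less_trans)
    then have "norm (X t \<omega> - x) \<le> r" using r by (simp add: ennreal_less_iff)
    then have b: "?b < ennreal r" using n \<omega> t by (auto simp: K_iff not_le)
    have "(SUP s\<in>{0..2 * t}. ennreal (norm (X s \<omega> - x))) \<le> ?a + ?b"
    proof (rule SUP_least)
      fix s assume s: "s \<in> {0..2 * t}"
      show "ennreal (norm (X s \<omega> - x)) \<le> ?a + ?b"
      proof (cases "s \<le> t")
        case True
        then have "ennreal (norm (X s \<omega> - x)) \<le> ?a" using s by (intro le) auto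
        also have "\<dots> \<le> ?a + ?b" by simp
        finally show ?thesis .
      next
        case False
        have "norm (X s \<omega> - x) \<le> norm (X t \<omega> - x) + norm (X s \<omega> - X t \<omega>)"
          using norm_triangle_ineq[of "X t \<omega> - x" "X s \<omega> - X t \<omega>"] by simp
        then have "ennreal (norm (X s \<omega> - x)) \<le>
            ennreal (norm (X t \<omega> - x)) + ennreal (norm (X (t + (s - t)) \<omega> - X t \<omega>))"
          by (simp add: ennreal_plus[symmetric] ennreal_leI del: ennreal_plus)
        also have "\<dots> \<le> ?a + ?b"
          using False s t by (intro add_mono le SUP_upper) auto
        finally show ?thesis .
      qed
    qed
    also have "\<dots> < ennreal r + ennreal r" using a b by (rule add_strict_mono)
    also have "\<dots> = ennreal (2 * r)" using r by (simp add: ennreal_plus[symmetric] del: ennreal_plus)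
    finally show False using \<omega> by auto
  qed
  then have "emeasure (P x)
      {\<omega> \<in> space M. ennreal (2 * r) \<le> (SUP s\<in>{0..2 * t}. ennreal (norm (X s \<omega> - x)))} \<le>
      emeasure (P x) (H x \<union> K t)"
    using H K[OF t] by (intro emeasure_mono) auto
  also have "\<dots> \<le> emeasure (P x) (H x) + emeasure (P x) (K t)"
    using H K[OF t] by (rule emeasure_subadditive)
  also have "\<dots> \<le> p + p"
    using Kt p[of x] r by (intro add_mono) (auto simp: H_def)
  also have "p + p = 2 * p" by (rule mult_2[symmetric])
  finally show ?thesis .
qed

end

section \<open>Choice of times from the finite integral\<close>

text \<open>
  The integrand need not be measurable, so the integral is a lower integral. It is bounded below
  through the step function that takes on each interval the infimum of \<open>g\<close>.
\<close>

lemma nn_integral_inverse_obtains_summable: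
  fixes g :: "real \<Rightarrow> ennreal" and q :: real
  assumes fin: "(\<integral>\<^sup>+t\<in>{0<..1}. ennreal (1 / t) * g t \<partial>lebesgue) < \<infinity>" and q: "0 < q" "q < 1"
  obtains \<tau> :: "nat \<Rightarrow> real"
  where "\<And>n. q ^ Suc n < \<tau> n" "\<And>n. \<tau> n \<le> q ^ n" "(\<Sum>n. g (\<tau> n)) < \<infinity>"
proof -
  \<comment> \<open>The half-open intervals are disjoint and \<open>I n\<close> has length
    \<open>q ^ n * (1 - q)\<close>. As \<open>1 / t\<close> is at least \<open>1 / q ^ n\<close>
    there, each contributes at least \<open>a n * (1 - q)\<close> to the integral.\<close>
  define I where "I n = {q ^ Suc n<..q ^ n}" for n
  define a where "a n = (INF t\<in>I n. g t)" for n
  have lt: "q ^ Suc n < q ^ n" for n using q by simp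
  have disj: "n = m" if "t \<in> I n" "t \<in> I m" for n m t
  proof (rule ccontr)
    assume "n \<noteq> m"
    then have "Suc n \<le> m \<or> Suc m \<le> n" by auto
    then have "q ^ m \<le> q ^ Suc n \<or> q ^ n \<le> q ^ Suc m"
      using q by (auto intro: power_decreasing simp del: power_Suc)
    then show False using that by (auto simp: I_def)
  qed
  have meas [measurable]: "I n \<in> sets lebesgue" for n by (simp add: I_def)
  have "(\<Sum>n. a n * ennreal (1 - q)) =
      (\<Sum>n. \<integral>\<^sup>+t. a n * ennreal (1 / q ^ n) * indicator (I n) t \<partial>lebesgue)"
  proof (rule suminf_cong)
    fix n
    have "ennreal (1 / q ^ n) * ennreal (q ^ n - q ^ Suc n) = ennreal (1 - q)"
      using q lt[of n] by (subst ennreal_mult[symmetric]) (auto simp: field_simps)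
    then show "a n * ennreal (1 - q) =
        (\<integral>\<^sup>+t. a n * ennreal (1 / q ^ n) * indicator (I n) t \<partial>lebesgue)"
      using lt[of n] by (subst nn_integral_cmult_indicator[OF meas])
        (simp add: I_def mult.assoc del: power_Suc)
  qed
  also have "\<dots> = (\<integral>\<^sup>+t. (\<Sum>n. a n * ennreal (1 / q ^ n) * indicator (I n) t) \<partial>lebesgue)"
    by (rule nn_integral_suminf[symmetric]) measurable
  also have "\<dots> \<le> (\<integral>\<^sup>+t\<in>{0<..1}. ennreal (1 / t) * g t \<partial>lebesgue)"
  proof (rule nn_integral_mono)
    fix t
    show "(\<Sum>n. a n * ennreal (1 / q ^ n) * indicator (I n) t) \<le>
        ennreal (1 / t) * g t * indicator {0<..1} t"
    proof (cases "\<exists>m. t \<in> I m")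
      case True
      then obtain m where m: "t \<in> I m" ..
      have "0 < q ^ Suc m" "q ^ m \<le> 1" using q by (auto simp: power_le_one)
      then have t: "0 < t" "t \<le> 1" "t \<le> q ^ m" using m by (auto simp: I_def simp del: power_Suc)
      \<comment> \<open>By disjointness only the term of the interval containing \<open>t\<close>
        survives.\<close>
      have "a n * ennreal (1 / q ^ n) * indicator (I n) t =
          (if n = m then a n * ennreal (1 / q ^ n) else 0)" for n
        using disj[OF _ m, of n] m by (cases "n = m") (auto split: split_indicator)
      then have "(\<Sum>n. a n * ennreal (1 / q ^ n) * indicator (I n) t) = a m * ennreal (1 / q ^ m)"
        using sums_unique[OF sums_single[of m "\<lambda>n. a n * ennreal (1 / q ^ n)"]] by simp
      also have "\<dots> \<le> g t * ennreal (1 / t)"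
        using m t by (intro mult_mono) (auto simp: a_def INF_lower ennreal_leI frac_le)
      finally show ?thesis using t by (simp add: mult.commute)
    qed simp
  qed
  finally have "(\<Sum>n. a n) * ennreal (1 - q) < \<infinity>"
    using fin by (simp add: le_less_trans)
  then have a: "(\<Sum>n. a n) < \<infinity>"
    using q by (auto simp: ennreal_mult_less_top)
  \<comment> \<open>The infimum may not be attained, so a summable slack is allowed. The inequality
    is strict because \<open>a n\<close> is finite.\<close>
  have "\<exists>t\<in>I n. g t < a n + ennreal ((1 / 2) ^ n)" for n
  proof -
    have "a n \<le> (\<Sum>n. a n)"
      using sum_le_suminf[of a "{n}"] by simp
    then have "a n < a n + ennreal ((1 / 2) ^ n)"
      using a by (cases "a n") (auto simp: ennreal_plus[symmetric] ennreal_less_iff top_unique simp del: ennreal_plus)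
    then show ?thesis unfolding a_def INF_less_iff .
  qed
  then obtain \<tau> where \<tau>: "\<And>n. \<tau> n \<in> I n" "\<And>n. g (\<tau> n) < a n + ennreal ((1 / 2) ^ n)"
    by metis
  have "(\<Sum>n. g (\<tau> n)) \<le> (\<Sum>n. a n + ennreal ((1 / 2) ^ n))"
    using \<tau>(2) by (intro suminf_le) (auto simp: less_imp_le)
  also have "\<dots> = (\<Sum>n. a n) + (\<Sum>n. ennreal ((1 / 2) ^ n))"
    by (rule suminf_add[symmetric]) auto
  also have "\<dots> < \<infinity>"
    using a by (simp add: ennreal_suminf_neq_top less_top)
  finally show ?thesis
    using that[of \<tau>] \<tau>(1) by (auto simp: I_def)
qed

text \<open>Take the predecessor of the least \<open>m\<close> with \<open>q ^ m < t\<close>; that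
  \<open>m\<close> is not \<open>0\<close> because \<open>t \<le> 1\<close>.\<close>

lemma ex_power_bracket:
  fixes q t :: real
  assumes "0 < q" "q < 1" "0 < t" "t \<le> 1"
  obtains n where "q ^ Suc n < t" "t \<le> q ^ n"
proof -
  obtain m where "q ^ m < t" using real_arch_pow_inv[of t q] assms by blast
  then have L: "q ^ (LEAST m. q ^ m < t) < t" by (rule LeastI)
  then obtain n where n: "(LEAST m. q ^ m < t) = Suc n"
    using assms by (cases "LEAST m. q ^ m < t") auto
  then have "\<not> q ^ n < t" using not_less_Least[of n "\<lambda>m. q ^ m < t"] by simp
  with L n that[of n] show ?thesis by simp
qed

section \<open>Borel-Cantelli and interpolation between the chosen times\<close>

theorem theorem5p1:
  fixes M :: "'w measure"
    and P :: "real ^ 'd \<Rightarrow> 'w measure"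
    and X :: "real \<Rightarrow> 'w \<Rightarrow> real ^ 'd"
    and f :: "real \<Rightarrow> real"
    and x :: "real ^ 'd"
  assumes "markov_process M P X"
    and "\<And>\<omega>. \<omega> \<in> space M \<Longrightarrow> cadlag (\<lambda>t. X t \<omega>)"
    and "\<And>t. t \<in> {0..1} \<Longrightarrow> 0 \<le> f t"
    and "mono_on {0..1} f"
    and "(\<integral>\<^sup>+t\<in>{0<..1}. ennreal (1 / t) *
            (SUP z\<in>{z. norm (z - x) \<le> f t}.
               emeasure (P z) {\<omega> \<in> space M.
                 (SUP s\<in>{0..t}. ennreal (norm (X s \<omega> - z))) \<ge> ennreal (f t)}) \<partial>lebesgue) < \<infinity>"
  shows "AE \<omega> in P x.
           Limsup (at_right 0)
             (\<lambda>t. (SUP s\<in>{0..t}. ennreal (norm (X s \<omega> - x))) / ennreal (f t)) \<le> 4"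
proof -
  interpret markov_process M P X by fact
  interpret prob_space "P x" by (rule prob_space_law)
  define S where "S t \<omega> = (SUP s\<in>{0..t}. ennreal (norm (X s \<omega> - x)))" for t \<omega>
  define g where "g t = (SUP z\<in>{z. norm (z - x) \<le> f t}. emeasure (P z) {\<omega> \<in> space M.
    ennreal (f t) \<le> (SUP s\<in>{0..t}. ennreal (norm (X s \<omega> - z)))})" for t
  \<comment> \<open>The value must satisfy \<open>q < 1\<close> and
    \<open>1 \<le> 2 * q ^ 2\<close>; here \<open>2 * q ^ 2\<close> is \<open>9 / 8\<close>.\<close>
  define q :: real where "q = 3 / 4"
  have q: "0 < q" "q < 1" by (simp_all add: q_def)
  obtain \<tau> where \<tau>: "\<And>n. q ^ Suc n < \<tau> n" "\<And>n. \<tau> n \<le> q ^ n" "(\<Sum>n. g (\<tau> n)) < \<infinity>"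
    using nn_integral_inverse_obtains_summable[OF _ q, of g] assms(5) unfolding g_def by blast
  have \<tau>_pos: "0 < \<tau> n" for n
    using \<tau>(1)[of n] q zero_less_power[of q "Suc n"] by linarith
  have \<tau>_le: "\<tau> n \<le> 1" for n
    using \<tau>(2)[of n] q power_le_one[of q n] by linarith
  define A where "A n = {\<omega> \<in> space M. ennreal (2 * f (\<tau> n)) \<le> S (2 * \<tau> n) \<omega>}" for n
  have A: "A n \<in> events" for n
    unfolding A_def S_def using assms(2) \<tau>_pos[of n] by (intro sets_running_maximum) auto
  have A_le: "emeasure (P x) (A n) \<le> 2 * g (\<tau> n)" for n
    unfolding A_def S_def
  proof (rule running_maximum_doubling)
    fix z assume "norm (z - x) \<le> f (\<tau> n)"
    then show "emeasure (P z) {\<omega> \<in> space M.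
        ennreal (f (\<tau> n)) \<le> (SUP s\<in>{0..\<tau> n}. ennreal (norm (X s \<omega> - z)))} \<le> g (\<tau> n)"
      unfolding g_def by (intro SUP_upper) simp
  qed (use assms(2,3) \<tau>_pos[of n] \<tau>_le[of n] in auto)
  have "(\<Sum>n. emeasure (P x) (A n)) \<le> (\<Sum>n. 2 * g (\<tau> n))"
    by (intro suminf_le A_le) auto
  also have "\<dots> = 2 * (\<Sum>n. g (\<tau> n))" by simp
  also have "\<dots> < \<infinity>" using \<tau>(3) by (simp add: ennreal_mult_less_top)
  finally have "summable (\<lambda>n. prob (A n))"
    by (intro summable_suminf_not_top) (auto simp: emeasure_eq_measure)
  \<comment> \<open>Almost surely only finitely many of the doubled-ball exits \<open>A n\<close>
    occur.\<close>
  then have "AE \<omega> in P x. eventually (\<lambda>n. \<omega> \<in> space (P x) - A n) sequentially"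
    using A by (intro borel_cantelli_AE1) (auto simp: emeasure_eq_measure)
  then show ?thesis
  proof eventually_elim
    case (elim \<omega>)
    then obtain N where N: "\<And>n. N \<le> n \<Longrightarrow> S (2 * \<tau> n) \<omega> < ennreal (2 * f (\<tau> n))"
      by (auto simp: eventually_sequentially A_def space_law not_le)
    have "S t \<omega> / ennreal (f t) \<le> 4" if t: "t \<in> {0<..<q ^ N}" for t
    proof -
      have t1: "t \<le> 1" using t power_le_one[of q N] q by simp
      then obtain n where n: "q ^ Suc n < t" "t \<le> q ^ n"
        using ex_power_bracket[of q t] q t by auto
      have "N \<le> n"
      proof (rule ccontr)
        assume "\<not> N \<le> n"
        then have "q ^ N \<le> q ^ Suc n" using q by (intro power_decreasing) auto
        then show False using n t by auto
      qed
      \<comment> \<open>The index \<open>Suc n\<close> gives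
        \<open>\<tau> (Suc n) \<le> q ^ Suc n < t\<close> together with
        \<open>t \<le> 2 * \<tau> (Suc n)\<close>. The first lets \<open>f\<close> increase up to
        \<open>f t\<close>, the second lets the running maximum at \<open>t\<close> be bounded at
        the doubled time.\<close>
      have "q ^ n \<le> 2 * q ^ Suc (Suc n)" by (simp add: q_def)
      then have "t \<le> 2 * \<tau> (Suc n)" using \<tau>(1)[of "Suc n"] n by linarith
      then have "S t \<omega> \<le> S (2 * \<tau> (Suc n)) \<omega>"
        unfolding S_def by (intro SUP_subset_mono) auto
      also have "\<dots> < ennreal (2 * f (\<tau> (Suc n)))" using N \<open>N \<le> n\<close> by simp
      also have "\<dots> \<le> ennreal (2 * f t)"
        using mono_onD[OF assms(4), of "\<tau> (Suc n)" t] \<tau>_pos[of "Suc n"] \<tau>(2)[of "Suc n"] n t t1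
        by (intro ennreal_leI) auto
      finally have St: "S t \<omega> < ennreal (2 * f t)" .
      \<comment> \<open>Strictness excludes \<open>f t = 0\<close>, so the quotient is a genuine
        division.\<close>
      then have "0 < ennreal (2 * f t)" by (rule le_less_trans[OF zero_le])
      then have ft: "0 < f t" by simp
      have "S t \<omega> / ennreal (f t) \<le> ennreal (2 * f t) / ennreal (f t)"
        using St by (intro divide_right_mono_ennreal) simp
      \<comment> \<open>The bound reached is \<open>2\<close>, which lies below the claimed
        \<open>4\<close>.\<close>
      also have "\<dots> = 2" using ft by (simp add: divide_ennreal)
      finally show ?thesis by (rule order_trans) simp
    qed
    then show ?case
      unfolding S_def
      by (intro Limsup_bounded eventually_at_rightI[of 0 "q ^ N"]) (use q in auto)
  qed
qed

end
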